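(* Let $a=(a_1,\dots,a_n)$ and $b=(b_1,\dots,b_m)$ be probability vectors with positive entries, let $C=(c_{ij})\in\mathbb{R}_{\ge 0}^{n\times m}$, and let $M=\max_{1\le i\le n,\,1\le j\le m}c_{ij}$. Fix $\varepsilon>0$. For $\lambda>0$ let $\Gamma^{\varepsilon,\lambda}$ be the unique minimizer of the entropic partial optimal transport problem defining $\mathrm{OT}_{\varepsilon,\lambda}(a,b)$, and set $$\rho_\lambda=1-\sum_{i=1}^{n}\sum_{j=1}^{m}\Gamma^{\varepsilon,\lambda}_{ij}.$$ Then $$0\le \mathrm{OT}_{\varepsilon}(a,b)-\varepsilon-\mathrm{OT}_{\varepsilon,\lambda}(a,b)\le M\rho_\lambda+\varepsilon\rho_\lambda\bigl(2|\log\rho_\lambda|+\log(nm)+2\bigr),$$ where $\rho_\lambda|\log\rho_\lambda|$ is understood to be $0$ when $\rho_\lambda=0$. Consequently, $$\mathrm{OT}_{\varepsilon}(a,b)-\varepsilon-\mathrm{OT}_{\varepsilon,\lambda}(a,b)=O\left(\frac{\log\lambda}{\lambda}\right)\qquad\text{as }\lambda\to\infty.$$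
   Context: For nonnegative vectors $r,s$ of equal total mass, $\Pi(r,s)$ is the set of nonnegative matrices with row sums $r$ and column sums $s$. The extended marginals are $\widetilde a=(a_1,\dots,a_n,1)$ and $\widetilde b=(b_1,\dots,b_m,1)$. The extended cost matrix has entries $\widetilde c^{\lambda}_{ij}=c_{ij}-2\lambda$ if $1\le i\le n$ and $1\le j\le m$, and $\widetilde c^{\lambda}_{ij}=0$ otherwise (for $1\le i\le n+1$, $1\le j\le m+1$). For a nonnegative matrix $A$, $E(A)=\sum_{i,j}A_{ij}(\log A_{ij}-1)$, with $0\log 0=0$. The entropic partial optimal transport problem is $$\mathrm{OT}_{\varepsilon,\lambda}(a,b)=\min_{\Gamma\in\Pi(\widetilde a,\widetilde b)}\left\{\sum_{i=1}^{n+1}\sum_{j=1}^{m+1}\widetilde c^{\lambda}_{ij}\Gamma_{ij}+\varepsilon E(\Gamma)+2\lambda\right\};$$ it has a unique minimizer. The balanced entropic optimal transport value is $$\mathrm{OT}_{\varepsilon}(a,b)=\min_{\omega\in\Pi(a,b)}\left\{\sum_{i=1}^{n}\sum_{j=1}^{m}c_{ij}\omega_{ij}+\varepsilon E(\omega)\right\}.$$ *)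

theory Defs
  imports "HOL-Analysis.Analysis" "HOL-Library.Landau_Symbols"
begin

text \<open>
  Vectors of length \<open>n\<close> are indexed by a finite type \<open>'n\<close>. The index set with one additional
  point is \<open>'n option\<close>; the indices \<open>1, \<dots>, n\<close> become \<open>Some i\<close>, the index \<open>n + 1\<close> becomes \<open>None\<close>.
\<close>

definition couplings :: "real^'n \<Rightarrow> real^'m \<Rightarrow> (real^'m^'n) set" where
  "couplings r s = {A. (\<forall>i j. 0 \<le> A $ i $ j) \<and>
                       (\<forall>i. (\<Sum>j\<in>UNIV. A $ i $ j) = r $ i) \<and>
                       (\<forall>j. (\<Sum>i\<in>UNIV. A $ i $ j) = s $ j)}"

text \<open>The convention \<open>0 log 0 = 0\<close> holds automatically, since the product has the factor \<open>0\<close>.\<close>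

definition entropy_functional :: "real^'m^'n \<Rightarrow> real" where
  "entropy_functional A = (\<Sum>i\<in>UNIV. \<Sum>j\<in>UNIV. A $ i $ j * (ln (A $ i $ j) - 1))"

definition entropic_objective :: "real \<Rightarrow> real^'m^'n \<Rightarrow> real^'m^'n \<Rightarrow> real" where
  "entropic_objective \<epsilon> c A =
     (\<Sum>i\<in>UNIV. \<Sum>j\<in>UNIV. c $ i $ j * A $ i $ j) + \<epsilon> * entropy_functional A"

definition extended_marginal :: "real^'n \<Rightarrow> real^('n option)" where
  "extended_marginal a = (\<chi> i. case i of Some k \<Rightarrow> a $ k | None \<Rightarrow> 1)"

definition extended_cost :: "real \<Rightarrow> real^'m^'n \<Rightarrow> real^('m option)^('n option)" where
  "extended_cost lam c =
     (\<chi> i j. case (i, j) of (Some k, Some l) \<Rightarrow> c $ k $ l - 2 * lam | _ \<Rightarrow> 0)"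

definition partial_objective ::
    "real \<Rightarrow> real \<Rightarrow> real^'m^'n \<Rightarrow> real^('m option)^('n option) \<Rightarrow> real" where
  "partial_objective \<epsilon> lam c \<Gamma> = entropic_objective \<epsilon> (extended_cost lam c) \<Gamma> + 2 * lam"

text \<open>Both values are minima, not merely infima: \<open>LEAST\<close> denotes the attained least value.\<close>

definition entropic_OT :: "real \<Rightarrow> real^'m^'n \<Rightarrow> real^'n \<Rightarrow> real^'m \<Rightarrow> real" where
  "entropic_OT \<epsilon> c a b = (LEAST v. v \<in> entropic_objective \<epsilon> c ` couplings a b)"

definition entropic_partial_OT ::
    "real \<Rightarrow> real \<Rightarrow> real^'m^'n \<Rightarrow> real^'n \<Rightarrow> real^'m \<Rightarrow> real" where
  "entropic_partial_OT \<epsilon> lam c a b =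
     (LEAST v. v \<in> partial_objective \<epsilon> lam c ` couplings (extended_marginal a) (extended_marginal b))"

definition partial_minimizer ::
    "real \<Rightarrow> real \<Rightarrow> real^'m^'n \<Rightarrow> real^'n \<Rightarrow> real^'m \<Rightarrow> real^('m option)^('n option)" where
  "partial_minimizer \<epsilon> lam c a b =
     (THE \<Gamma>. is_arg_min (partial_objective \<epsilon> lam c)
               (\<lambda>A. A \<in> couplings (extended_marginal a) (extended_marginal b)) \<Gamma>)"

end

theory Submission
  imports Defs "HOL-Real_Asymp.Real_Asymp"
begin

text \<open>
  A coupling of \<open>a\<close> and \<open>b\<close>, extended by the single corner entry \<open>1\<close>, is a competitor in the
  partial problem; the corner contributes \<open>- \<epsilon>\<close>, which gives the lower bound. Conversely, let
  \<open>\<Gamma>\<close> be the partial minimizer with last column \<open>u\<close> and last row \<open>v\<close>, both of mass \<open>\<rho>\<close>. Adding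
  \<open>u v\<^sup>T / \<rho>\<close> to the inner block restores the marginals at cost at most \<open>M \<rho>\<close>, and all entropy
  comparisons reduce to the tangent inequality \<open>x ln y \<le> x (ln x - 1) + y\<close>. Finally, comparing
  \<open>\<Gamma>\<close> with a fixed competitor bounds \<open>2 \<lambda> \<rho>\<close> uniformly in \<open>\<lambda>\<close>, so \<open>\<rho> = O(1 / \<lambda>)\<close>, and the
  tangent inequality at \<open>y = 1 / \<lambda>\<close> gives \<open>\<rho> \<bar>ln \<rho>\<bar> = O(ln \<lambda> / \<lambda>)\<close>.
\<close>

section \<open>Tangent inequality and midpoint convexity of the entropy density\<close>

lemma mult_ln_less_tangent:
  fixes x y :: real
  assumes "0 \<le> x" "0 < y" "x \<noteq> y"
  shows "x * ln y < x * (ln x - 1) + y"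
proof (cases "x = 0")
  case False
  with assms have "x > 0" by simp
  have "ln (y / x) \<noteq> y / x - 1"
    using ln_eq_minus_one[of "y / x"] \<open>x > 0\<close> assms by auto
  moreover have "ln (y / x) \<le> y / x - 1"
    using \<open>x > 0\<close> assms by (intro ln_le_minus_one) auto
  ultimately have "x * ln (y / x) < x * (y / x - 1)"
    using \<open>x > 0\<close> by (intro mult_strict_left_mono) auto
  then show ?thesis
    using \<open>x > 0\<close> assms by (simp add: ln_div algebra_simps)
qed (use assms in auto)

text \<open>Convexity of x (ln x - 1), whose derivative is ln: its tangent at y is x ln y - y. The
  point of tangency y is chosen afresh in each later use; x may be 0, but y stays positive.\<close>

lemma mult_ln_le_tangent:
  fixes x y :: real
  assumes "0 \<le> x" "0 < y"
  shows "x * ln y \<le> x * (ln x - 1) + y"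
  using mult_ln_less_tangent[OF assms] by (cases "x = y") (auto simp: algebra_simps)

text \<open>Add the tangent inequalities at the midpoint z for x and for y; the terms in ln z
  combine to 2 z ln z. Since z is positive even if x or y is 0, boundary points are covered.\<close>

lemma entropy_midpoint_less:
  fixes x y :: real
  assumes "0 \<le> x" "0 \<le> y" "x \<noteq> y"
  shows "(x + y) / 2 * (ln ((x + y) / 2) - 1) < (x * (ln x - 1) + y * (ln y - 1)) / 2"
proof -
  define z where "z = (x + y) / 2"
  have z: "0 < z" "x \<noteq> z" "y \<noteq> z" "x + y = 2 * z" using assms by (auto simp: z_def)
  have "x * ln z + y * ln z < x * (ln x - 1) + y * (ln y - 1) + 2 * z"
    using mult_ln_less_tangent[of x z] mult_ln_less_tangent[of y z] z assms by linarith
  also have "x * ln z + y * ln z = 2 * z * ln z"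
    using z(4) by (simp flip: distrib_right)
  finally show ?thesis unfolding z_def[symmetric] by (simp add: algebra_simps)
qed

lemma entropy_midpoint_le:
  fixes x y :: real
  assumes "0 \<le> x" "0 \<le> y"
  shows "(x + y) / 2 * (ln ((x + y) / 2) - 1) \<le> (x * (ln x - 1) + y * (ln y - 1)) / 2"
  using entropy_midpoint_less[OF assms] by (cases "x = y") auto

section \<open>Existence and uniqueness of minimizers\<close>

lemma continuous_on_entropy: "continuous_on {0..} (\<lambda>x::real. x * (ln x - 1))"
proof (unfold continuous_on, intro ballI)
  fix x :: real assume "x \<in> {0..}"
  show "((\<lambda>x. x * (ln x - 1)) \<longlongrightarrow> x * (ln x - 1)) (at x within {0..})"
  proof (cases "x = 0")
    \<comment> \<open>The factor 0 makes the value at 0 equal to 0 whatever \<open>ln 0\<close> is,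
      and this agrees with the right limit.\<close>
    case True
    have "((\<lambda>x::real. x * (ln x - 1)) \<longlongrightarrow> 0) (at_right 0)" by real_asymp
    with True show ?thesis by (simp add: at_within_Ici_at_right)
  next
    case False
    then show ?thesis by (intro tendsto_intros) auto
  qed
qed

lemma entropic_objective_continuous:
  "continuous_on (couplings r s) (entropic_objective \<epsilon> c)"
  unfolding entropic_objective_def entropy_functional_def
  by (intro continuous_intros continuous_on_compose2[OF continuous_on_entropy])
     (auto simp: couplings_def)

text \<open>Weak inequalities and linear equations cut out a closed set. It is bounded because the
  norm is at most the sum of the absolute entries, which for nonnegative entries is the fixed total
  mass.\<close>

lemma compact_couplings: "compact (couplings r s)"
proof -
  have "couplings r s = (\<Inter>i. \<Inter>j. {A. 0 \<le> A $ i $ j}) \<inter>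
      (\<Inter>i. {A. (\<Sum>j\<in>UNIV. A $ i $ j) = r $ i}) \<inter>
      (\<Inter>j. {A. (\<Sum>i\<in>UNIV. A $ i $ j) = s $ j})"
    by (auto simp: couplings_def)
  also have "closed \<dots>"
    by (intro closed_Int closed_INT ballI closed_Collect_le closed_Collect_eq continuous_intros)
  finally have "closed (couplings r s)" .
  moreover have "bounded (couplings r s)"
  proof (rule boundedI)
    fix A assume A: "A \<in> couplings r s"
    have "norm A \<le> (\<Sum>i\<in>UNIV. norm (A $ i))"
      unfolding norm_vec_def[of A] by (rule L2_set_le_sum) auto
    also have "\<dots> \<le> (\<Sum>i\<in>UNIV. \<Sum>j\<in>UNIV. \<bar>A $ i $ j\<bar>)"
      by (intro sum_mono norm_le_l1_cart)
    also have "\<dots> = (\<Sum>i\<in>UNIV. r $ i)"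
      using A by (simp add: couplings_def)
    finally show "norm A \<le> (\<Sum>i\<in>UNIV. r $ i)" .
  qed
  ultimately show ?thesis by (simp add: compact_eq_bounded_closed)
qed

lemma couplings_midpoint:
  assumes "A \<in> couplings r s" "B \<in> couplings r s"
  shows "(1/2) *\<^sub>R (A + B) \<in> couplings r s"
  using assms by (simp add: couplings_def sum.distrib add_divide_distrib flip: sum_divide_distrib)

text \<open>The linear cost is exact at midpoints, so strictness comes from the entropy alone, at
  one entry where the two matrices differ.\<close>

lemma entropic_objective_midpoint_less:
  assumes "0 < \<epsilon>" "A \<in> couplings r s" "B \<in> couplings r s" "A \<noteq> B"
  shows "entropic_objective \<epsilon> c ((1/2) *\<^sub>R (A + B)) <
           (entropic_objective \<epsilon> c A + entropic_objective \<epsilon> c B) / 2"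
proof -
  have nonneg: "0 \<le> A $ i $ j" "0 \<le> B $ i $ j" for i j
    using assms by (auto simp: couplings_def)
  obtain i0 j0 where ne: "A $ i0 $ j0 \<noteq> B $ i0 $ j0"
    using \<open>A \<noteq> B\<close> by (auto simp: vec_eq_iff)
  define f where "f = (\<lambda>x::real. x * (ln x - 1))"
  have le: "f ((A $ i $ j + B $ i $ j) / 2) \<le> (f (A $ i $ j) + f (B $ i $ j)) / 2" for i j
    unfolding f_def by (intro entropy_midpoint_le nonneg)
  have "(\<Sum>i\<in>UNIV. \<Sum>j\<in>UNIV. f ((A $ i $ j + B $ i $ j) / 2)) <
      (\<Sum>i\<in>UNIV. \<Sum>j\<in>UNIV. (f (A $ i $ j) + f (B $ i $ j)) / 2)"
  proof (rule sum_strict_mono_ex1)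
    show "\<exists>i\<in>UNIV. (\<Sum>j\<in>UNIV. f ((A $ i $ j + B $ i $ j) / 2)) <
        (\<Sum>j\<in>UNIV. (f (A $ i $ j) + f (B $ i $ j)) / 2)"
    proof (intro bexI[of _ i0] sum_strict_mono_ex1)
      show "\<exists>j\<in>UNIV. f ((A $ i0 $ j + B $ i0 $ j) / 2) < (f (A $ i0 $ j) + f (B $ i0 $ j)) / 2"
        using entropy_midpoint_less[OF nonneg ne] by (auto simp: f_def)
    qed (use le in auto)
  qed (use le in \<open>auto intro: sum_mono\<close>)
  then have "entropy_functional ((1/2) *\<^sub>R (A + B)) <
      (entropy_functional A + entropy_functional B) / 2"
    by (simp add: entropy_functional_def f_def sum.distrib flip: sum_divide_distrib)
  then have "\<epsilon> * entropy_functional ((1/2) *\<^sub>R (A + B)) <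
      \<epsilon> * ((entropy_functional A + entropy_functional B) / 2)"
    using \<open>0 < \<epsilon>\<close> by simp
  then show ?thesis
    by (simp add: entropic_objective_def sum.distrib algebra_simps add_divide_distrib
        flip: sum_divide_distrib)
qed

text \<open>Existence is compactness with continuity. If two minimizers were distinct, their
  midpoint would be feasible with a strictly smaller value.\<close>

lemma ex1_entropic_objective_minimizer:
  assumes "0 < \<epsilon>" "couplings r s \<noteq> {}"
  shows "\<exists>!A. is_arg_min (entropic_objective \<epsilon> c) (\<lambda>A. A \<in> couplings r s) A"
proof (rule ex_ex1I)
  obtain A where "A \<in> couplings r s"
    "\<forall>B\<in>couplings r s. entropic_objective \<epsilon> c A \<le> entropic_objective \<epsilon> c B"
    using continuous_attains_inf[OF compact_couplings assms(2) entropic_objective_continuous]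
    by blast
  then show "\<exists>A. is_arg_min (entropic_objective \<epsilon> c) (\<lambda>A. A \<in> couplings r s) A"
    by (auto simp: is_arg_min_linorder)
next
  fix A B
  assume A: "is_arg_min (entropic_objective \<epsilon> c) (\<lambda>A. A \<in> couplings r s) A"
    and B: "is_arg_min (entropic_objective \<epsilon> c) (\<lambda>A. A \<in> couplings r s) B"
  show "A = B"
  proof (rule ccontr)
    assume "A \<noteq> B"
    with A B assms have "entropic_objective \<epsilon> c ((1/2) *\<^sub>R (A + B)) <
        (entropic_objective \<epsilon> c A + entropic_objective \<epsilon> c B) / 2"
      by (intro entropic_objective_midpoint_less) (auto simp: is_arg_min_linorder)
    moreover have "(1/2) *\<^sub>R (A + B) \<in> couplings r s"
      using A B by (intro couplings_midpoint) (auto simp: is_arg_min_linorder)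
    then have "entropic_objective \<epsilon> c A \<le> entropic_objective \<epsilon> c ((1/2) *\<^sub>R (A + B))"
      "entropic_objective \<epsilon> c B \<le> entropic_objective \<epsilon> c ((1/2) *\<^sub>R (A + B))"
      using A B by (auto simp: is_arg_min_linorder)
    ultimately show False by simp
  qed
qed

text \<open>On the reals \<open>LEAST\<close> is informative only once a minimum is attained; this
  links both optimal values to minimizers.\<close>

lemma Least_image_arg_min:
  fixes f :: "'a \<Rightarrow> 'b::linorder"
  assumes "is_arg_min f (\<lambda>x. x \<in> S) x"
  shows "(LEAST v. v \<in> f ` S) = f x"
  using assms by (intro Least_equality) (auto simp: is_arg_min_linorder)

lemma entropic_OT_attained:
  assumes "0 < \<epsilon>" "couplings a b \<noteq> {}"
  obtains \<omega> where "\<omega> \<in> couplings a b" "entropic_OT \<epsilon> c a b = entropic_objective \<epsilon> c \<omega>"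
    "\<And>\<omega>'. \<omega>' \<in> couplings a b \<Longrightarrow> entropic_OT \<epsilon> c a b \<le> entropic_objective \<epsilon> c \<omega>'"
proof -
  obtain \<omega> where \<omega>: "is_arg_min (entropic_objective \<epsilon> c) (\<lambda>A. A \<in> couplings a b) \<omega>"
    using ex1_entropic_objective_minimizer[OF assms] by blast
  from \<omega> have "entropic_OT \<epsilon> c a b = entropic_objective \<epsilon> c \<omega>"
    unfolding entropic_OT_def by (rule Least_image_arg_min)
  with \<omega> that show ?thesis by (auto simp: is_arg_min_linorder)
qed

lemma partial_minimizer_is_arg_min:
  assumes "0 < \<epsilon>" "couplings (extended_marginal a) (extended_marginal b) \<noteq> {}"
  shows "is_arg_min (partial_objective \<epsilon> lam c)
    (\<lambda>A. A \<in> couplings (extended_marginal a) (extended_marginal b)) (partial_minimizer \<epsilon> lam c a b)"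
proof -
  \<comment> \<open>The two objectives differ by the constant 2 \<open>lam\<close>, so they have the
    same minimizers.\<close>
  have "is_arg_min (partial_objective \<epsilon> lam c) P =
      is_arg_min (entropic_objective \<epsilon> (extended_cost lam c)) P" for P
    by (auto simp: is_arg_min_def partial_objective_def)
  then have "\<exists>!\<Gamma>. is_arg_min (partial_objective \<epsilon> lam c)
      (\<lambda>A. A \<in> couplings (extended_marginal a) (extended_marginal b)) \<Gamma>"
    using ex1_entropic_objective_minimizer[OF assms] by simp
  then show ?thesis unfolding partial_minimizer_def by (rule theI')
qed

section \<open>Balanced couplings as competitors in the partial problem\<close>

lemma sum_UNIV_option:
  fixes f :: "'a::finite option \<Rightarrow> 'b::comm_monoid_add"
  shows "(\<Sum>x\<in>UNIV. f x) = f None + (\<Sum>x\<in>UNIV. f (Some x))"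
  by (simp add: UNIV_option_conv sum.reindex)

definition extend_coupling :: "real^'m^'n \<Rightarrow> real^('m option)^('n option)" where
  "extend_coupling \<omega> =
     (\<chi> i j. case i of Some k \<Rightarrow> (case j of Some l \<Rightarrow> \<omega> $ k $ l | None \<Rightarrow> 0)
                     | None \<Rightarrow> (case j of Some l \<Rightarrow> 0 | None \<Rightarrow> 1))"

lemma extend_coupling_in_couplings:
  assumes "\<omega> \<in> couplings a b"
  shows "extend_coupling \<omega> \<in> couplings (extended_marginal a) (extended_marginal b)"
  using assms
  by (auto simp: couplings_def extend_coupling_def extended_marginal_def sum_UNIV_option
      split: option.split)

lemma sum_couplings:
  assumes "A \<in> couplings r s"
  shows "(\<Sum>i\<in>UNIV. \<Sum>j\<in>UNIV. A $ i $ j) = (\<Sum>i\<in>UNIV. r $ i)"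
  using assms by (simp add: couplings_def)

text \<open>The inner block has mass 1, so its reward -2 \<open>lam\<close> cancels the additive
  constant; the corner contributes 1 (ln 1 - 1) = -1 to the entropy.\<close>

lemma partial_objective_extend_coupling:
  assumes "\<omega> \<in> couplings a b" "(\<Sum>i\<in>UNIV. a $ i) = 1"
  shows "partial_objective \<epsilon> lam c (extend_coupling \<omega>) = entropic_objective \<epsilon> c \<omega> - \<epsilon>"
proof -
  have "(\<Sum>i\<in>UNIV. \<Sum>j\<in>UNIV. (c $ i $ j - 2 * lam) * \<omega> $ i $ j) =
      (\<Sum>i\<in>UNIV. \<Sum>j\<in>UNIV. c $ i $ j * \<omega> $ i $ j) - 2 * lam"
    using sum_couplings[OF assms(1)] assms(2)
    by (simp add: left_diff_distrib sum_subtractf flip: sum_distrib_left)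
  then show ?thesis
    by (simp add: partial_objective_def entropic_objective_def entropy_functional_def
        extended_cost_def extend_coupling_def sum_UNIV_option algebra_simps)
qed

section \<open>Entropy estimates for a fixed mass and for an increment\<close>

lemma sum_mult_ln_ge:
  fixes u :: "'a::finite \<Rightarrow> real"
  assumes "\<And>i. 0 \<le> u i" "(\<Sum>i\<in>UNIV. u i) = t" "0 < t"
  shows "t * ln t - t * ln (real CARD('a)) \<le> (\<Sum>i\<in>UNIV. u i * ln (u i))"
proof -
  have N: "real CARD('a) > 0" by simp
  \<comment> \<open>The uniform vector minimizes the sum, so the tangents are taken at its entry;
    when summed, the terms -u i and the constants cancel.\<close>
  have "(\<Sum>i\<in>UNIV. u i * ln (t / CARD('a))) \<le> (\<Sum>i\<in>UNIV. u i * (ln (u i) - 1) + t / CARD('a))"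
    by (intro sum_mono mult_ln_le_tangent) (use assms in auto)
  then have "t * ln (t / CARD('a)) \<le> (\<Sum>i\<in>UNIV. u i * ln (u i))"
    using assms(2) by (simp add: sum.distrib right_diff_distrib sum_subtractf flip: sum_distrib_right)
  then show ?thesis using assms(3) N by (simp add: ln_div right_diff_distrib)
qed

text \<open>The tangent at x + d bounds x ln (x + d) by x ln x + d, and the remaining term d ln (x +
  d) is nonpositive because x + d is at most 1.\<close>

lemma mult_ln_add_le:
  fixes x d :: real
  assumes "0 \<le> x" "0 \<le> d" "x + d \<le> 1"
  shows "(x + d) * ln (x + d) \<le> x * ln x + d"
proof (cases "x + d = 0")
  case False
  with assms have pos: "0 < x + d" by simp
  then have "d * ln (x + d) \<le> 0"
    using assms by (intro mult_nonneg_nonpos) auto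
  with mult_ln_le_tangent[OF assms(1) pos] show ?thesis
    by (simp add: algebra_simps)
next
  case True
  with assms have "x = 0" "d = 0" by auto
  then show ?thesis by simp
qed

section \<open>Feasible extended couplings with missing mass \<open>\<rho>\<close>, and their
  repair\<close>

locale extended_coupling =
  fixes a :: "real^'n" and b :: "real^'m" and \<Gamma> :: "real^('m option)^('n option)" and \<rho> :: real
  assumes a_sum: "(\<Sum>i\<in>UNIV. a $ i) = 1" and b_sum: "(\<Sum>j\<in>UNIV. b $ j) = 1"
    and \<Gamma>: "\<Gamma> \<in> couplings (extended_marginal a) (extended_marginal b)"
    and \<rho>_def: "\<rho> = 1 - (\<Sum>i\<in>UNIV. \<Sum>j\<in>UNIV. \<Gamma> $ Some i $ Some j)"
begin

lemma nonneg: "0 \<le> \<Gamma> $ i $ j"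
  using \<Gamma> by (simp add: couplings_def)

lemma row: "\<Gamma> $ Some i $ None + (\<Sum>j\<in>UNIV. \<Gamma> $ Some i $ Some j) = a $ i"
  using \<Gamma> by (auto simp: couplings_def extended_marginal_def sum_UNIV_option dest!: spec[of _ "Some i"])

lemma col: "\<Gamma> $ None $ Some j + (\<Sum>i\<in>UNIV. \<Gamma> $ Some i $ Some j) = b $ j"
  using \<Gamma> by (auto simp: couplings_def extended_marginal_def sum_UNIV_option dest!: spec[of _ "Some j"])

lemma sum_last_col: "(\<Sum>i\<in>UNIV. \<Gamma> $ Some i $ None) = \<rho>"
proof -
  have "(\<Sum>i\<in>UNIV. \<Gamma> $ Some i $ None + (\<Sum>j\<in>UNIV. \<Gamma> $ Some i $ Some j)) = 1"
    by (simp add: row a_sum)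
  then show ?thesis by (simp add: sum.distrib \<rho>_def)
qed

lemma sum_last_row: "(\<Sum>j\<in>UNIV. \<Gamma> $ None $ Some j) = \<rho>"
proof -
  have "(\<Sum>j\<in>UNIV. \<Gamma> $ None $ Some j + (\<Sum>i\<in>UNIV. \<Gamma> $ Some i $ Some j)) = 1"
    by (simp add: col b_sum)
  moreover have "(\<Sum>j\<in>UNIV. \<Sum>i\<in>UNIV. \<Gamma> $ Some i $ Some j) = 1 - \<rho>"
    by (subst sum.swap) (simp add: \<rho>_def)
  ultimately show ?thesis by (simp add: sum.distrib)
qed

lemma corner: "\<Gamma> $ None $ None = 1 - \<rho>"
proof -
  have "\<Gamma> $ None $ None + (\<Sum>j\<in>UNIV. \<Gamma> $ None $ Some j) = 1"
    using \<Gamma> by (auto simp: couplings_def extended_marginal_def sum_UNIV_option dest!: spec[of _ None])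
  then show ?thesis by (simp add: sum_last_row)
qed

lemma \<rho>_nonneg: "0 \<le> \<rho>"
  using sum_last_col by (metis nonneg sum_nonneg)

lemma \<rho>_le_1: "\<rho> \<le> 1"
  using corner nonneg[of None None] by simp

text \<open>The reward on the inner mass 1 - \<open>\<rho>\<close> and the constant 2
  \<open>lam\<close> merge into a penalty on the missing mass. The upper bound discards this penalty
  as nonnegative; the decay of \<open>\<rho>\<close> is extracted from it.\<close>

lemma partial_objective_eq:
  "partial_objective \<epsilon> lam c \<Gamma> =
     (\<Sum>i\<in>UNIV. \<Sum>j\<in>UNIV. c $ i $ j * \<Gamma> $ Some i $ Some j) + 2 * lam * \<rho> + \<epsilon> * entropy_functional \<Gamma>"
proof -
  have "(\<Sum>i\<in>UNIV. \<Sum>j\<in>UNIV. (c $ i $ j - 2 * lam) * \<Gamma> $ Some i $ Some j) =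
      (\<Sum>i\<in>UNIV. \<Sum>j\<in>UNIV. c $ i $ j * \<Gamma> $ Some i $ Some j) - 2 * lam * (1 - \<rho>)"
    by (simp add: \<rho>_def left_diff_distrib sum_subtractf flip: sum_distrib_left)
  then show ?thesis
    by (simp add: partial_objective_def entropic_objective_def
        extended_cost_def sum_UNIV_option algebra_simps)
qed

text \<open>The final -2 is minus the total mass: 1 - \<open>\<rho>\<close> in the inner block,
  \<open>\<rho>\<close> in each border, 1 - \<open>\<rho>\<close> in the corner.\<close>

lemma entropy_functional_eq:
  "entropy_functional \<Gamma> = (\<Sum>i\<in>UNIV. \<Sum>j\<in>UNIV. \<Gamma> $ Some i $ Some j * ln (\<Gamma> $ Some i $ Some j))
     + (\<Sum>i\<in>UNIV. \<Gamma> $ Some i $ None * ln (\<Gamma> $ Some i $ None))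
     + (\<Sum>j\<in>UNIV. \<Gamma> $ None $ Some j * ln (\<Gamma> $ None $ Some j)) + (1 - \<rho>) * ln (1 - \<rho>) - 2"
  using sum_last_col sum_last_row corner \<rho>_def
  by (simp add: entropy_functional_def sum_UNIV_option right_diff_distrib sum_subtractf sum.distrib)

text \<open>The missing mass is put back as the normalised product of the last column and the last row.
  For \<open>\<rho> = 0\<close> both vanish, and so does the correction, since \<open>x / 0 = 0\<close>.\<close>

definition repair :: "real^'m^'n" where
  "repair = (\<chi> i j. \<Gamma> $ Some i $ Some j + \<Gamma> $ Some i $ None * \<Gamma> $ None $ Some j / \<rho>)"

lemma last_col_le: "\<Gamma> $ Some i $ None \<le> \<rho>"
  using member_le_sum[of i UNIV "\<lambda>i. \<Gamma> $ Some i $ None"] sum_last_col nonneg by simp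

lemma last_row_le: "\<Gamma> $ None $ Some j \<le> \<rho>"
  using member_le_sum[of j UNIV "\<lambda>j. \<Gamma> $ None $ Some j"] sum_last_row nonneg by simp

text \<open>The correction has the last column as row sums and the last row as column sums, exactly
  what the inner block lacks by \<open>row\<close> and \<open>col\<close>.\<close>

lemma repair_in_couplings: "repair \<in> couplings a b"
proof -
  have "(\<Sum>j\<in>UNIV. repair $ i $ j) =
      (\<Sum>j\<in>UNIV. \<Gamma> $ Some i $ Some j) + \<Gamma> $ Some i $ None * \<rho> / \<rho>" for i
    by (simp add: repair_def sum.distrib sum_last_row flip: sum_distrib_left sum_divide_distrib)
  then have "(\<Sum>j\<in>UNIV. repair $ i $ j) = a $ i" for i
    using row[of i] last_col_le[of i] nonneg[of "Some i" None] by (cases "\<rho> = 0") auto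
  moreover have "(\<Sum>i\<in>UNIV. repair $ i $ j) =
      (\<Sum>i\<in>UNIV. \<Gamma> $ Some i $ Some j) + \<rho> * \<Gamma> $ None $ Some j / \<rho>" for j
    by (simp add: repair_def sum.distrib sum_last_col flip: sum_distrib_right sum_divide_distrib)
  then have "(\<Sum>i\<in>UNIV. repair $ i $ j) = b $ j" for j
    using col[of j] last_row_le[of j] nonneg[of None "Some j"] by (cases "\<rho> = 0") auto
  ultimately show ?thesis
    by (auto simp: couplings_def repair_def nonneg \<rho>_nonneg)
qed

lemma sum_correction:
  "(\<Sum>i\<in>UNIV. \<Sum>j\<in>UNIV. \<Gamma> $ Some i $ None * \<Gamma> $ None $ Some j / \<rho>) = \<rho>"
proof -
  have "(\<Sum>i\<in>UNIV. \<Sum>j\<in>UNIV. \<Gamma> $ Some i $ None * \<Gamma> $ None $ Some j / \<rho>) =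
      (\<Sum>i\<in>UNIV. \<Gamma> $ Some i $ None) * (\<Sum>j\<in>UNIV. \<Gamma> $ None $ Some j) / \<rho>"
    by (simp only: sum_product sum_divide_distrib)
  then show ?thesis by (simp add: sum_last_col sum_last_row)
qed

text \<open>The correction raises the inner entropy sum by at most \<open>\<rho>\<close>, and the
  discarded corner costs at most another \<open>\<rho>\<close>; these give the 2. The borders give
  the logarithms, and the masses 1 against 2 give the +1.\<close>

lemma entropy_repair_le:
  "entropy_functional repair \<le> entropy_functional \<Gamma> + 1
     + \<rho> * (2 * \<bar>ln \<rho>\<bar> + ln (real (CARD('n) * CARD('m))) + 2)"
proof -
  let ?d = "\<lambda>i j. \<Gamma> $ Some i $ None * \<Gamma> $ None $ Some j / \<rho>"
  \<comment> \<open>Total mass 1 bounds every entry by 1, as \<open>mult_ln_add_le\<close>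
    requires.\<close>
  have le1: "repair $ i $ j \<le> 1" for i j
  proof -
    have "repair $ i $ j \<le> (\<Sum>j\<in>UNIV. repair $ i $ j)"
      using repair_in_couplings by (intro member_le_sum) (auto simp: couplings_def)
    also have "\<dots> \<le> (\<Sum>i\<in>UNIV. \<Sum>j\<in>UNIV. repair $ i $ j)"
      using repair_in_couplings
      by (intro member_le_sum[of i UNIV "\<lambda>i. \<Sum>j\<in>UNIV. repair $ i $ j"] sum_nonneg)
         (auto simp: couplings_def)
    also have "\<dots> = 1" using sum_couplings[OF repair_in_couplings] a_sum by simp
    finally show ?thesis .
  qed
  have "(\<Sum>i\<in>UNIV. \<Sum>j\<in>UNIV. repair $ i $ j * ln (repair $ i $ j)) \<le>
      (\<Sum>i\<in>UNIV. \<Sum>j\<in>UNIV. \<Gamma> $ Some i $ Some j * ln (\<Gamma> $ Some i $ Some j) + ?d i j)"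
  proof (intro sum_mono)
    fix i j
    show "repair $ i $ j * ln (repair $ i $ j) \<le>
        \<Gamma> $ Some i $ Some j * ln (\<Gamma> $ Some i $ Some j) + ?d i j"
      using mult_ln_add_le[of "\<Gamma> $ Some i $ Some j" "?d i j"] le1[of i j]
      by (simp add: repair_def nonneg \<rho>_nonneg)
  qed
  then have inner: "entropy_functional repair \<le>
      (\<Sum>i\<in>UNIV. \<Sum>j\<in>UNIV. \<Gamma> $ Some i $ Some j * ln (\<Gamma> $ Some i $ Some j)) + \<rho> - 1"
    using sum_couplings[OF repair_in_couplings] a_sum
    by (simp add: entropy_functional_def right_diff_distrib sum_subtractf sum.distrib sum_correction)
  have corner_ent: "- \<rho> \<le> (1 - \<rho>) * ln (1 - \<rho>)"
    using mult_ln_le_tangent[of "1 - \<rho>" 1] \<rho>_le_1 by (simp add: algebra_simps)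
  \<comment> \<open>Each border has mass \<open>\<rho>\<close>, so its entropy is at least that of
    the uniform spread over n or m entries; the two cardinalities multiply inside the
    logarithm.\<close>
  have "2 * \<rho> * ln \<rho> - \<rho> * ln (real (CARD('n) * CARD('m))) \<le>
      (\<Sum>i\<in>UNIV. \<Gamma> $ Some i $ None * ln (\<Gamma> $ Some i $ None)) +
      (\<Sum>j\<in>UNIV. \<Gamma> $ None $ Some j * ln (\<Gamma> $ None $ Some j))"
  proof (cases "\<rho> = 0")
    case True
    then have "\<Gamma> $ Some i $ None = 0" "\<Gamma> $ None $ Some j = 0" for i j
      using last_col_le[of i] last_row_le[of j] nonneg[of "Some i" None] nonneg[of None "Some j"]
      by auto
    with True show ?thesis by simp
  next
    case False
    with \<rho>_nonneg have "0 < \<rho>" by simp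
    then show ?thesis
      using sum_mult_ln_ge[OF nonneg sum_last_col] sum_mult_ln_ge[OF nonneg sum_last_row]
      by (simp add: ln_mult algebra_simps)
  qed
  moreover have "\<rho> * ln \<rho> = - (\<rho> * \<bar>ln \<rho>\<bar>)"
    using \<rho>_nonneg \<rho>_le_1 by (cases "\<rho> = 0") auto
  ultimately show ?thesis
    using inner corner_ent entropy_functional_eq by (simp add: algebra_simps)
qed

text \<open>The added mass is \<open>\<rho>\<close> in total, at unit cost at most M.\<close>

lemma cost_repair_le:
  assumes "\<And>i j. c $ i $ j \<le> M"
  shows "(\<Sum>i\<in>UNIV. \<Sum>j\<in>UNIV. c $ i $ j * repair $ i $ j) \<le>
    (\<Sum>i\<in>UNIV. \<Sum>j\<in>UNIV. c $ i $ j * \<Gamma> $ Some i $ Some j) + M * \<rho>"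
proof -
  let ?d = "\<lambda>i j. \<Gamma> $ Some i $ None * \<Gamma> $ None $ Some j / \<rho>"
  have "(\<Sum>i\<in>UNIV. \<Sum>j\<in>UNIV. c $ i $ j * repair $ i $ j) \<le>
      (\<Sum>i\<in>UNIV. \<Sum>j\<in>UNIV. c $ i $ j * \<Gamma> $ Some i $ Some j + M * ?d i j)"
  proof (intro sum_mono)
    fix i j
    have "c $ i $ j * ?d i j \<le> M * ?d i j"
      by (intro mult_right_mono assms divide_nonneg_nonneg mult_nonneg_nonneg nonneg \<rho>_nonneg)
    then show "c $ i $ j * repair $ i $ j \<le> c $ i $ j * \<Gamma> $ Some i $ Some j + M * ?d i j"
      by (simp add: repair_def distrib_left)
  qed
  also have "\<dots> = (\<Sum>i\<in>UNIV. \<Sum>j\<in>UNIV. c $ i $ j * \<Gamma> $ Some i $ Some j) + M * (\<Sum>i\<in>UNIV. \<Sum>j\<in>UNIV. ?d i j)"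
    by (simp only: sum.distrib sum_distrib_left)
  finally show ?thesis by (simp only: sum_correction)
qed

lemma entropic_objective_repair_le:
  assumes "\<And>i j. c $ i $ j \<le> M" "0 \<le> \<epsilon>" "0 \<le> lam"
  shows "entropic_objective \<epsilon> c repair - \<epsilon> - partial_objective \<epsilon> lam c \<Gamma> \<le>
    M * \<rho> + \<epsilon> * \<rho> * (2 * \<bar>ln \<rho>\<bar> + ln (real (CARD('n) * CARD('m))) + 2)"
proof -
  have "0 \<le> 2 * lam * \<rho>" using assms \<rho>_nonneg by simp
  moreover have "\<epsilon> * entropy_functional repair \<le> \<epsilon> * (entropy_functional \<Gamma> + 1
     + \<rho> * (2 * \<bar>ln \<rho>\<bar> + ln (real (CARD('n) * CARD('m))) + 2))"
    using entropy_repair_le assms by (intro mult_left_mono) auto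
  ultimately show ?thesis
    using cost_repair_le[of c M, OF assms(1)] unfolding partial_objective_eq entropic_objective_def
    by (simp add: algebra_simps)
qed

text \<open>The tangent at 1 bounds each entropy summand below by -1, and the transport cost is
  nonnegative, so a bound on the objective bounds the penalty.\<close>

lemma two_lam_rho_le:
  assumes "\<And>i j. 0 \<le> c $ i $ j" "0 \<le> \<epsilon>"
  shows "2 * lam * \<rho> \<le> partial_objective \<epsilon> lam c \<Gamma> + \<epsilon> * (CARD('n option) * CARD('m option))"
proof -
  have "(\<Sum>i\<in>(UNIV::'n option set). \<Sum>j\<in>(UNIV::'m option set). - 1) \<le> entropy_functional \<Gamma>"
    unfolding entropy_functional_def
  proof (intro sum_mono)
    fix i j
    show "- 1 \<le> \<Gamma> $ i $ j * (ln (\<Gamma> $ i $ j) - 1)"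
      using mult_ln_le_tangent[OF nonneg[of i j], of 1] by simp
  qed
  then have "- real (CARD('n option) * CARD('m option)) \<le> entropy_functional \<Gamma>"
    by (simp add: algebra_simps)
  then have "\<epsilon> * (- real (CARD('n option) * CARD('m option))) \<le> \<epsilon> * entropy_functional \<Gamma>"
    using assms(2) by (rule mult_left_mono)
  moreover have "0 \<le> (\<Sum>i\<in>UNIV. \<Sum>j\<in>UNIV. c $ i $ j * \<Gamma> $ Some i $ Some j)"
    by (intro sum_nonneg mult_nonneg_nonneg assms nonneg)
  ultimately show ?thesis unfolding partial_objective_eq mult_minus_right by linarith
qed

end

section \<open>The two-sided bound and the rate for large \<open>lam\<close>\<close>

theorem theorem3p4:
  fixes a :: "real^'n" and b :: "real^'m" and c :: "real^'m^'n"
    and \<epsilon> M :: real and \<rho> :: "real \<Rightarrow> real"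
  assumes a_pos: "\<And>i. 0 < a $ i" and a_sum: "(\<Sum>i\<in>UNIV. a $ i) = 1"
    and b_pos: "\<And>j. 0 < b $ j" and b_sum: "(\<Sum>j\<in>UNIV. b $ j) = 1"
    and c_nonneg: "\<And>i j. 0 \<le> c $ i $ j"
    and M_eq: "M = Max (range (\<lambda>(i, j). c $ i $ j))"
    and eps_pos: "0 < \<epsilon>"
    and rho_eq: "\<And>lam. 0 < lam \<Longrightarrow>
      \<rho> lam = 1 - (\<Sum>i\<in>UNIV. \<Sum>j\<in>UNIV. partial_minimizer \<epsilon> lam c a b $ Some i $ Some j)"
  shows "(\<forall>lam>0.
            0 \<le> entropic_OT \<epsilon> c a b - \<epsilon> - entropic_partial_OT \<epsilon> lam c a b \<and>
            entropic_OT \<epsilon> c a b - \<epsilon> - entropic_partial_OT \<epsilon> lam c a b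
              \<le> M * \<rho> lam
                + \<epsilon> * \<rho> lam * (2 * \<bar>ln (\<rho> lam)\<bar> + ln (real (CARD('n) * CARD('m))) + 2))
       \<and> (\<lambda>lam. entropic_OT \<epsilon> c a b - \<epsilon> - entropic_partial_OT \<epsilon> lam c a b)
            \<in> O[at_top](\<lambda>lam. ln lam / lam)"
proof -
  let ?C = "couplings (extended_marginal a) (extended_marginal b)"
  define gap where "gap lam = entropic_OT \<epsilon> c a b - \<epsilon> - entropic_partial_OT \<epsilon> lam c a b" for lam
  define L where "L = ln (real (CARD('n) * CARD('m)))"
  have c_le: "c $ i $ j \<le> M" for i j
    unfolding M_eq by (intro Max_ge) (auto intro: image_eqI[of _ _ "(i, j)"])
  have M_nonneg: "0 \<le> M" using c_nonneg c_le order.trans by blast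
  have L_nonneg: "0 \<le> L"
  proof -
    have "1 \<le> CARD('n) * CARD('m)" by simp
    then have "1 \<le> real (CARD('n) * CARD('m))" by linarith
    then show ?thesis unfolding L_def by (rule ln_ge_zero)
  qed

  \<comment> \<open>The independent coupling makes both feasible sets nonempty, the extended one
    through \<open>extend_coupling\<close>.\<close>
  have "(\<chi> i j. a $ i * b $ j) \<in> couplings a b"
    using a_pos b_pos a_sum b_sum
    by (auto simp: couplings_def less_imp_le simp flip: sum_distrib_left sum_distrib_right)
  then have ne: "couplings a b \<noteq> {}" by blast
  obtain \<omega> where \<omega>: "\<omega> \<in> couplings a b" "entropic_OT \<epsilon> c a b = entropic_objective \<epsilon> c \<omega>"
    and OT_le: "\<And>\<omega>'. \<omega>' \<in> couplings a b \<Longrightarrow> entropic_OT \<epsilon> c a b \<le> entropic_objective \<epsilon> c \<omega>'"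
    using entropic_OT_attained[OF eps_pos ne] by metis
  have ext: "extend_coupling \<omega> \<in> ?C" using \<omega>(1) by (rule extend_coupling_in_couplings)

  define \<Gamma> where "\<Gamma> lam = partial_minimizer \<epsilon> lam c a b" for lam
  have min: "is_arg_min (partial_objective \<epsilon> lam c) (\<lambda>A. A \<in> ?C) (\<Gamma> lam)" for lam
    unfolding \<Gamma>_def by (rule partial_minimizer_is_arg_min) (use eps_pos ext in auto)
  have pOT: "entropic_partial_OT \<epsilon> lam c a b = partial_objective \<epsilon> lam c (\<Gamma> lam)" for lam
    unfolding entropic_partial_OT_def using min by (rule Least_image_arg_min)
  have coupling: "extended_coupling a b (\<Gamma> lam) (\<rho> lam)" if "0 < lam" for lam
    using min[of lam] a_sum b_sum rho_eq[OF that]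
    by unfold_locales (auto simp: is_arg_min_linorder \<Gamma>_def)

  have lower: "0 \<le> gap lam" for lam
    using min[of lam] ext partial_objective_extend_coupling[OF \<omega>(1) a_sum, of \<epsilon> lam c]
    by (auto simp: is_arg_min_linorder gap_def pOT \<omega>(2))
  have upper: "gap lam \<le> M * \<rho> lam + \<epsilon> * \<rho> lam * (2 * \<bar>ln (\<rho> lam)\<bar> + L + 2)" if "0 < lam" for lam
  proof -
    interpret extended_coupling a b "\<Gamma> lam" "\<rho> lam" by (rule coupling[OF that])
    show ?thesis
      using OT_le[OF repair_in_couplings] entropic_objective_repair_le[of c M \<epsilon> lam] c_le eps_pos that
      by (simp add: gap_def pOT L_def)
  qed

  \<comment> \<open>By \<open>lower\<close> the partial value is at most \<open>entropic_OT\<close>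
    minus \<open>\<epsilon>\<close>; inserting this into \<open>two_lam_rho_le\<close> bounds
    \<open>lam\<close> times \<open>\<rho> lam\<close> by K, uniformly in
    \<open>lam\<close>.\<close>
  define K where "K = (entropic_OT \<epsilon> c a b - \<epsilon> + \<epsilon> * (CARD('n option) * CARD('m option))) / 2"
  have rho: "0 \<le> \<rho> lam \<and> \<rho> lam \<le> 1 \<and> \<rho> lam \<le> K / lam" if "0 < lam" for lam
  proof -
    interpret extended_coupling a b "\<Gamma> lam" "\<rho> lam" by (rule coupling[OF that])
    have "lam * \<rho> lam \<le> K"
      using two_lam_rho_le[of c \<epsilon> lam] c_nonneg eps_pos lower[of lam]
      by (simp add: K_def gap_def pOT)
    with that \<rho>_nonneg \<rho>_le_1 show ?thesis by (simp add: field_simps)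
  qed
  have K_nonneg: "0 \<le> K" using rho[of 1] by simp
  \<comment> \<open>D collects the coefficients of ln \<open>lam\<close> / \<open>lam\<close> after
    \<open>\<rho> lam\<close> is replaced by K q and the logarithmic term by (K + 1) q.\<close>
  define D where "D = M * K + \<epsilon> * (2 * (K + 1) + (L + 2) * K)"
  have "gap \<in> O[at_top](\<lambda>lam. ln lam / lam)"
  proof (rule bigoI)
    show "\<forall>\<^sub>F lam in at_top. norm (gap lam) \<le> D * norm (ln lam / lam)"
      \<comment> \<open>From exp 1 on ln \<open>lam\<close> is at least 1, so terms of order 1 /
        \<open>lam\<close> are absorbed into q.\<close>
      using eventually_ge_at_top[of "exp 1"]
    proof eventually_elim
      case (elim lam)
      have lam: "0 < lam" using elim by (rule less_le_trans[OF exp_gt_zero])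
      have ln1: "1 \<le> ln lam" using elim lam by (simp add: ln_ge_iff)
      note r = rho[OF lam]
      define q where "q = ln lam / lam"
      have inv_le: "1 / lam \<le> q" using ln1 lam by (simp add: q_def divide_right_mono)
      have rK: "\<rho> lam \<le> K * q"
        using r mult_left_mono[OF inv_le K_nonneg] by simp
      have rln: "\<rho> lam * \<bar>ln (\<rho> lam)\<bar> \<le> (K + 1) * q"
      proof -
        have "\<rho> lam * \<bar>ln (\<rho> lam)\<bar> = - (\<rho> lam * ln (\<rho> lam))"
          using r by (cases "\<rho> lam = 0") auto
        \<comment> \<open>The tangent at 1 / \<open>lam\<close> trades ln
          (\<open>\<rho> lam\<close>) for -ln \<open>lam\<close>, so only an upper bound on
          \<open>\<rho> lam\<close> matters, however small it is.\<close>
        also have "\<dots> \<le> \<rho> lam * ln lam + 1 / lam"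
          using mult_ln_le_tangent[of "\<rho> lam" "1 / lam"] r lam
          by (simp add: ln_div algebra_simps)
        also have "\<dots> \<le> K / lam * ln lam + q"
          using r ln1 inv_le by (intro add_mono mult_right_mono) auto
        finally show ?thesis by (simp add: q_def algebra_simps add_divide_distrib)
      qed
      have "gap lam \<le> M * \<rho> lam + \<epsilon> * (2 * (\<rho> lam * \<bar>ln (\<rho> lam)\<bar>) + (L + 2) * \<rho> lam)"
        using upper[OF lam] by (simp add: algebra_simps)
      also have "\<dots> \<le> M * (K * q) + \<epsilon> * (2 * ((K + 1) * q) + (L + 2) * (K * q))"
        using M_nonneg L_nonneg eps_pos rK rln
        by (intro add_mono mult_left_mono) auto
      also have "\<dots> = D * q" by (simp add: D_def algebra_simps)
      finally show ?case using lower[of lam] ln1 lam by (simp add: q_def)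
    qed
  qed
  with lower upper show ?thesis unfolding gap_def[abs_def] L_def by blast
qed

end
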